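(* Let $V$, $M$, $M_1$, $M_2$, $\mathcal Z$, $\hat\mu$, $S$, $\mathcal N$, $\mathcal H_2$, $C_{ir}$, $\mathcal R$ and $\mathcal M_{2,r}$ be as defined in the context. Suppose that: (1') (jointly exchangeable splitting mechanism) $(V^\sigma,M_1^\sigma,M_2^\sigma)\stackrel d=(V,M_1,M_2)$ for every $\sigma\in\Sigma_{\mathcal N}$, and additionally $M\ge M_1+M_2$ entrywise; (2) (network covariates) $\mathcal Z^\sigma=\zeta(\mathcal X^\sigma)$ for every permutation $\sigma$ of $[n]$; (3) either the sampling mechanism is deterministic node splitting, or the model is permutation invariant in the sense that $\boldsymbol{\hat\mu}^{\mathrm{split},\sigma}=\bigl(\hat\mu(\mathcal I^{\mathrm{split},\sigma}_{ij};\mathcal T^{\mathrm{split},\sigma})\bigr)_{1\le i,j\le n}$ for every permutation $\sigma$ of $[n]$. Let $\mathcal B\subseteq\{1,\dots,n\}$. Then for any $i\in\mathcal B$ and any $t\in[0,1]$, $$P\left(C_{ir}\le t\mid \mathcal R=r,\ \mathcal M_{2,r}=\mathcal B\right)\le t.$$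
   Context: Let $[n]=\{1,\dots,n\}$. For an array $B=(B_{ij})_{i,j\in[n]}$ and a permutation $\sigma$ of $[n]$, $B^\sigma=(B_{\sigma(i),\sigma(j)})_{i,j\in[n]}$. Data: $V=(V_{ij})_{i,j\in[n]}$ with $V_{ij}=(Y_{ij},X_i,X_j,E_{ij})$, where $Y_{ij}$ is a real response, $X_i$ a node covariate, and $E_{ij}$ an edge covariate. $M$ is a random binary $n\times n$ matrix indicating which pairs are sampled. $M_1$ and $M_2$ are binary $n\times n$ matrices indicating membership of pairs in the training set and in the calibration set (which includes the test point), respectively. $\mathcal N\subseteq[n]$ is the set of nodes that have nonzero probability of belonging to an edge in the graph corresponding to $M_2$, and $\Sigma_{\mathcal N}$ is the group of permutations $\sigma$ of $[n]$ with $\sigma(i)=i$ for all $i\notin\mathcal N$. Deterministic node splitting: for a fixed partition $D_1\cup D_2$ of $[n]$, $M_1(i,j)=M_{ij}\mathbf 1(i,j\in D_1)$ and $M_2(i,j)=M_{ij}\mathbf 1(i,j\in D_2)$. Network summary statistics: $\mathcal X=(\mathcal X_{ij})_{i,j\in[n]}$ with $\mathcal X_{ij}=(X_i,X_j,E_{ij},M_{ij})$, and $\mathcal Z=\zeta(\mathcal X)$ for a measurable function $\zeta$, where $\mathcal Z$ is an array with entries $(\mathcal Z_i,\mathcal Z_j,\mathcal Z_{ij})$ (node-level and pair-level summaries); below the subscript $ij$ on $\mathcal Z$ refers to the $(i,j)$ entry of this array. $\hat Z_1,\dots,\hat Z_n$ are nodal summary statistics (such as node degree) among the node-level components of $\mathcal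 Z$, so that they are covered by condition (2); it is assumed that their ranks are well defined (no ties). Model: with $\mathcal H_1=\{(i,j)\in[n]^2: M_1(i,j)=1\}$ and $\mathcal H_2=\{(i,j)\in[n]^2: M_2(i,j)=1\}$, $$\mathcal T^{\mathrm{split}}=(V_{ij},\mathcal Z_{ij})_{(i,j)\in\mathcal H_1},\qquad \mathcal I^{\mathrm{split}}=(\mathcal X_{ij},\mathcal Z_{ij},M_2(i,j))_{(i,j)\in[n]^2},$$ and, for a permutation $\sigma$, $\mathcal T^{\mathrm{split},\sigma}=(V^\sigma_{ij},\mathcal Z^\sigma_{ij})_{(i,j):\, M_1^\sigma(i,j)=1}$ and $\mathcal I^{\mathrm{split},\sigma}=(\mathcal X^\sigma_{ij},\mathcal Z^\sigma_{ij},M^\sigma_2(i,j))_{(i,j)\in[n]^2}$. The matrix of fitted values $\boldsymbol{\hat\mu}^{\mathrm{split}}\in\mathbb R^{n\times n}$ has entries $\boldsymbol{\hat\mu}^{\mathrm{split}}_{ij}=\hat\mu(\mathcal I^{\mathrm{split}}_{ij};\mathcal T^{\mathrm{split}})$, and $\boldsymbol{\hat\mu}^{\mathrm{split},\sigma}$ is this matrix with rows and columns permuted by $\sigma$. Scores: for a nonconformity score $s:\mathbb R\times\mathbb R\to\mathbb R$, $S_{ij}=s(Y_{ij},\boldsymbol{\hat\mu}^{\mathrm{split}}_{ij})$. With $\mathcal H_2(\cdot,r)=\{(j,r)\in\mathcal H_2: j\in[n]\}$, $$C_{ir}=\frac1{|\mathcal H_2(\cdot,r)|}\sum_{(j,r)\in\mathcal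 H_2}\mathbf 1\bigl(\{S_{jr}\ge S_{ir}\}\cap\{(i,r)\in\mathcal H_2\}\bigr).$$ Selection: for some pre-specified $1\le k\le n$, $\mathcal R=r$ if $\mathrm{rank}(\hat Z_r,\{\hat Z_1,\dots,\hat Z_n\})=k$. For $\mathcal B\subseteq\{1,\dots,n\}$, $\mathcal M_{2,r}=\mathcal B$ if $M_2(i,r)=1$ for all $i\in\mathcal B$ and $M_2(i,r)=0$ for all $i\notin\mathcal B$.
   Formalization: Condition (1') is assumed for the joint law of (V, M, M_1, M_2) rather than (V, M_1, M_2), and r is assumed not to lie in B (no self-pair (r,r) in the calibration set); without either of these the claim is false. *)

theory Defs
  imports "HOL-Probability.Probability" "HOL-Combinatorics.Permutations"
begin

text \<open>The node set \<open>[n]\<close> is a finite type \<open>'n\<close>, so that \<open>n = CARD('n)\<close>. Arrays indexed by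
  \<open>[n] \<times> [n]\<close> are functions on \<open>'n \<times> 'n\<close>; binary matrices are Boolean arrays. Node covariates,
  edge covariates, node summaries and pair summaries take values in arbitrary measurable spaces
  \<open>MX\<close>, \<open>ME\<close>, \<open>MZn\<close>, \<open>MZp\<close>.\<close>

definition permute :: "('n \<Rightarrow> 'n) \<Rightarrow> ('n \<times> 'n \<Rightarrow> 'b) \<Rightarrow> 'n \<times> 'n \<Rightarrow> 'b" where
  "permute \<sigma> B = (\<lambda>(i, j). B (\<sigma> i, \<sigma> j))"

text \<open>One realisation of \<open>Y\<close>, \<open>(X\<^sub>i)\<close>, \<open>(E\<^sub>i\<^sub>j)\<close>, \<open>M\<close>, \<open>M\<^sub>1\<close> and \<open>M\<^sub>2\<close> (in this order).\<close>

record ('n, 'x, 'e) dyadic_data =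
  resp :: "'n \<times> 'n \<Rightarrow> real"
  node_cov :: "'n \<Rightarrow> 'x"
  edge_cov :: "'n \<times> 'n \<Rightarrow> 'e"
  sampled :: "'n \<times> 'n \<Rightarrow> bool"
  train :: "'n \<times> 'n \<Rightarrow> bool"
  calib :: "'n \<times> 'n \<Rightarrow> bool"

definition V_array :: "('n, 'x, 'e) dyadic_data \<Rightarrow> 'n \<times> 'n \<Rightarrow> real \<times> 'x \<times> 'x \<times> 'e" where
  "V_array d = (\<lambda>(i, j). (resp d (i, j), node_cov d i, node_cov d j, edge_cov d (i, j)))"

definition X_array :: "('n, 'x, 'e) dyadic_data \<Rightarrow> 'n \<times> 'n \<Rightarrow> 'x \<times> 'x \<times> 'e \<times> bool" where
  "X_array d = (\<lambda>(i, j). (node_cov d i, node_cov d j, edge_cov d (i, j), sampled d (i, j)))"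

text \<open>The summary function \<open>\<zeta>\<close> returns the node-level and the pair-level summaries; the array
  \<open>\<Z>\<close> built from them has entries \<open>(\<Z>\<^sub>i, \<Z>\<^sub>j, \<Z>\<^sub>i\<^sub>j)\<close>.\<close>

definition Z_array ::
  "(('n \<times> 'n \<Rightarrow> 'c) \<Rightarrow> ('n \<Rightarrow> 'zn) \<times> ('n \<times> 'n \<Rightarrow> 'zp)) \<Rightarrow> ('n \<times> 'n \<Rightarrow> 'c) \<Rightarrow> 'n \<times> 'n \<Rightarrow> 'zn \<times> 'zn \<times> 'zp"
  where "Z_array \<zeta> x = (\<lambda>(i, j). (fst (\<zeta> x) i, fst (\<zeta> x) j, snd (\<zeta> x) (i, j)))"

text \<open>The training data form a family indexed by the random set \<open>\<H>\<^sub>1\<close>, i.e. a partial map with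
  domain \<open>\<H>\<^sub>1\<close>.\<close>

definition T_split ::
  "('n \<times> 'n \<Rightarrow> 'v) \<Rightarrow> ('n \<times> 'n \<Rightarrow> 'z) \<Rightarrow> ('n \<times> 'n \<Rightarrow> bool) \<Rightarrow> 'n \<times> 'n \<Rightarrow> ('v \<times> 'z) option" where
  "T_split v z m1 = (\<lambda>p. if m1 p then Some (v p, z p) else None)"

definition I_split ::
  "('n \<times> 'n \<Rightarrow> 'c) \<Rightarrow> ('n \<times> 'n \<Rightarrow> 'z) \<Rightarrow> ('n \<times> 'n \<Rightarrow> bool) \<Rightarrow> 'n \<times> 'n \<Rightarrow> 'c \<times> 'z \<times> bool" where
  "I_split x z m2 = (\<lambda>p. (x p, z p, m2 p))"

definition fitted :: "('i \<Rightarrow> 't \<Rightarrow> real) \<Rightarrow> ('n \<times> 'n \<Rightarrow> 'i) \<Rightarrow> 't \<Rightarrow> 'n \<times> 'n \<Rightarrow> real" where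
  "fitted \<mu> I T = (\<lambda>p. \<mu> (I p) T)"

definition mu_split where
  "mu_split \<zeta> \<mu> d =
     fitted \<mu> (I_split (X_array d) (Z_array \<zeta> (X_array d)) (calib d))
              (T_split (V_array d) (Z_array \<zeta> (X_array d)) (train d))"

definition score where
  "score \<zeta> \<mu> s d = (\<lambda>p. s (resp d p, mu_split \<zeta> \<mu> d p))"

definition calib_index ::
  "('n \<times> 'n \<Rightarrow> real) \<Rightarrow> ('n \<times> 'n \<Rightarrow> bool) \<Rightarrow> 'n \<Rightarrow> 'n \<Rightarrow> real" where
  "calib_index S m2 i r =
     1 / real (card {j. m2 (j, r)}) *
     (\<Sum>j\<in>{j. m2 (j, r)}. of_bool (S (j, r) \<ge> S (i, r) \<and> m2 (i, r)))"

definition C_index where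
  "C_index \<zeta> \<mu> s d i r = calib_index (score \<zeta> \<mu> s d) (calib d) i r"

text \<open>Each nodal statistic is a real-valued function \<open>h\<close> (e.g. a coordinate) of the node-level
  summary of the same node.\<close>

definition Z_hat where
  "Z_hat \<zeta> h d = (\<lambda>i. h (fst (\<zeta> (X_array d)) i))"

text \<open>Ascending ranks, starting at 1.\<close>

definition rank_of :: "('n \<Rightarrow> real) \<Rightarrow> 'n \<Rightarrow> nat" where
  "rank_of z r = card {j. z j \<le> z r}"

definition selected_node :: "nat \<Rightarrow> ('n \<Rightarrow> real) \<Rightarrow> 'n" where
  "selected_node k z = (THE r. rank_of z r = k)"

text \<open>The set \<open>\<B>\<close> with \<open>\<M>\<^sub>2\<^sub>,\<^sub>r = \<B>\<close>. If the pair \<open>(r, r)\<close> is never a calibration pair, then \<open>r\<close> is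
  never a member.\<close>

definition calib_nbrs :: "('n, 'x, 'e) dyadic_data \<Rightarrow> 'n \<Rightarrow> 'n set" where
  "calib_nbrs d r = {i. calib d (i, r)}"

subsection \<open>Measurable structure\<close>

text \<open>\<open>Some\<close>-values carry the \<open>\<sigma>\<close>-algebra of \<open>N\<close>, and \<open>None\<close> is an additional atom.\<close>

definition option_measure :: "'b measure \<Rightarrow> 'b option measure" where
  "option_measure N =
     sigma (insert None (Some ` space N)) (insert {None} ((`) Some ` sets N))"

definition V_entry :: "'x measure \<Rightarrow> 'e measure \<Rightarrow> (real \<times> 'x \<times> 'x \<times> 'e) measure" where
  "V_entry MX ME = borel \<Otimes>\<^sub>M MX \<Otimes>\<^sub>M MX \<Otimes>\<^sub>M ME"

definition X_entry :: "'x measure \<Rightarrow> 'e measure \<Rightarrow> ('x \<times> 'x \<times> 'e \<times> bool) measure" where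
  "X_entry MX ME = MX \<Otimes>\<^sub>M MX \<Otimes>\<^sub>M ME \<Otimes>\<^sub>M count_space UNIV"

definition Z_entry :: "'zn measure \<Rightarrow> 'zp measure \<Rightarrow> ('zn \<times> 'zn \<times> 'zp) measure" where
  "Z_entry MZn MZp = MZn \<Otimes>\<^sub>M MZn \<Otimes>\<^sub>M MZp"

abbreviation arrays :: "'b measure \<Rightarrow> ('n \<times> 'n \<Rightarrow> 'b) measure" where
  "arrays N \<equiv> Pi\<^sub>M UNIV (\<lambda>_. N)"

definition random_dyadic_data ::
  "'a measure \<Rightarrow> 'x measure \<Rightarrow> 'e measure \<Rightarrow> ('a \<Rightarrow> ('n, 'x, 'e) dyadic_data) \<Rightarrow> bool" where
  "random_dyadic_data P MX ME D \<longleftrightarrow>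
     (\<forall>p. (\<lambda>\<omega>. resp (D \<omega>) p) \<in> borel_measurable P) \<and>
     (\<forall>i. (\<lambda>\<omega>. node_cov (D \<omega>) i) \<in> measurable P MX) \<and>
     (\<forall>p. (\<lambda>\<omega>. edge_cov (D \<omega>) p) \<in> measurable P ME) \<and>
     (\<forall>p. (\<lambda>\<omega>. sampled (D \<omega>) p) \<in> measurable P (count_space UNIV)) \<and>
     (\<forall>p. (\<lambda>\<omega>. train (D \<omega>) p) \<in> measurable P (count_space UNIV)) \<and>
     (\<forall>p. (\<lambda>\<omega>. calib (D \<omega>) p) \<in> measurable P (count_space UNIV))"

subsection \<open>Hypotheses on the sampling mechanism, the summaries and the model\<close>

definition active_nodes :: "'a measure \<Rightarrow> ('a \<Rightarrow> ('n, 'x, 'e) dyadic_data) \<Rightarrow> 'n set" where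
  "active_nodes P D =
     {i. \<P>(\<omega> in P. \<exists>j. calib (D \<omega>) (i, j) \<or> calib (D \<omega>) (j, i)) > 0}"

text \<open>The law in question is that of \<open>(V, M, M\<^sub>1, M\<^sub>2)\<close>. The matrix \<open>M\<close> has to be part of the tuple:
  it enters the summaries through \<open>X_array\<close>, hence also the selected node, and it is not a function
  of the other three components.\<close>

definition exchangeable_splitting ::
  "'a measure \<Rightarrow> 'x measure \<Rightarrow> 'e measure \<Rightarrow> ('a \<Rightarrow> ('n, 'x, 'e) dyadic_data) \<Rightarrow> bool" where
  "exchangeable_splitting P MX ME D \<longleftrightarrow>
     (let L = arrays (V_entry MX ME) \<Otimes>\<^sub>M arrays (count_space UNIV) \<Otimes>\<^sub>M
              arrays (count_space UNIV) \<Otimes>\<^sub>M arrays (count_space UNIV)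
      in \<forall>\<sigma>. \<sigma> permutes active_nodes P D \<longrightarrow>
           distr P L (\<lambda>\<omega>. (permute \<sigma> (V_array (D \<omega>)), permute \<sigma> (sampled (D \<omega>)),
                           permute \<sigma> (train (D \<omega>)), permute \<sigma> (calib (D \<omega>)))) =
           distr P L (\<lambda>\<omega>. (V_array (D \<omega>), sampled (D \<omega>), train (D \<omega>), calib (D \<omega>)))) \<and>
     (AE \<omega> in P. \<forall>p. (of_bool (sampled (D \<omega>) p) :: nat) \<ge>
                      of_bool (train (D \<omega>) p) + of_bool (calib (D \<omega>) p))"

definition network_covariates where
  "network_covariates P \<zeta> D \<longleftrightarrow>
     (\<forall>\<sigma>. \<sigma> permutes UNIV \<longrightarrow>
        (AE \<omega> in P. permute \<sigma> (Z_array \<zeta> (X_array (D \<omega>))) =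
                    Z_array \<zeta> (permute \<sigma> (X_array (D \<omega>)))))"

definition deterministic_node_splitting ::
  "'a measure \<Rightarrow> ('a \<Rightarrow> ('n, 'x, 'e) dyadic_data) \<Rightarrow> bool" where
  "deterministic_node_splitting P D \<longleftrightarrow>
     (\<exists>D1 D2. D1 \<union> D2 = UNIV \<and> D1 \<inter> D2 = {} \<and>
        (AE \<omega> in P. \<forall>i j.
           (train (D \<omega>) (i, j) \<longleftrightarrow> sampled (D \<omega>) (i, j) \<and> i \<in> D1 \<and> j \<in> D1) \<and>
           (calib (D \<omega>) (i, j) \<longleftrightarrow> sampled (D \<omega>) (i, j) \<and> i \<in> D2 \<and> j \<in> D2)))"

definition permutation_invariant_model where
  "permutation_invariant_model P \<zeta> \<mu> D \<longleftrightarrow>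
     (\<forall>\<sigma>. \<sigma> permutes UNIV \<longrightarrow>
        (AE \<omega> in P.
           let d = D \<omega>; z = Z_array \<zeta> (X_array d) in
             permute \<sigma> (mu_split \<zeta> \<mu> d) =
             fitted \<mu> (I_split (permute \<sigma> (X_array d)) (permute \<sigma> z) (permute \<sigma> (calib d)))
                      (T_split (permute \<sigma> (V_array d)) (permute \<sigma> z) (permute \<sigma> (train d)))))"

end

theory Submission
  imports Defs
begin

text \<open>Given \<open>\<R> = r\<close> and \<open>\<M>\<^sub>2\<^sub>,\<^sub>r = \<B>\<close>, the nodes of \<open>\<B>\<close> are exchangeable: a transposition of two of
  them fixes \<open>r\<close>, hence preserves the conditioning event, and carries \<open>C\<^sub>i\<^sub>r\<close> to \<open>C\<^sub>j\<^sub>r\<close>. So the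
  probability in question is the same for all members of \<open>\<B>\<close>, while pointwise at most
  \<open>t |\<B>|\<close> of the values \<open>C\<^sub>j\<^sub>r\<close> can be \<open>\<le> t\<close>. Under deterministic node splitting a
  permutation of \<open>\<B> \<subseteq> D\<^sub>2\<close> leaves the training data untouched, so that the fitted values are
  equivariant for any model.\<close>

subsection \<open>The action of permutations on the data\<close>

text \<open>The action is put on the whole record because \<open>mu_split\<close>,
  \<open>C_index\<close> and \<open>Z_hat\<close> are functions of the record: each can then be
  recomputed from relabelled data and compared with its relabelled value.\<close>

definition permute_data ::
  "('n \<Rightarrow> 'n) \<Rightarrow> ('n, 'x, 'e) dyadic_data \<Rightarrow> ('n, 'x, 'e) dyadic_data" where
  "permute_data \<sigma> d =
     \<lparr>resp = permute \<sigma> (resp d), node_cov = node_cov d \<circ> \<sigma>, edge_cov = permute \<sigma> (edge_cov d),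
      sampled = permute \<sigma> (sampled d), train = permute \<sigma> (train d), calib = permute \<sigma> (calib d)\<rparr>"

lemma permute_data_simps [simp]:
  "resp (permute_data \<sigma> d) = permute \<sigma> (resp d)"
  "node_cov (permute_data \<sigma> d) = node_cov d \<circ> \<sigma>"
  "edge_cov (permute_data \<sigma> d) = permute \<sigma> (edge_cov d)"
  "sampled (permute_data \<sigma> d) = permute \<sigma> (sampled d)"
  "train (permute_data \<sigma> d) = permute \<sigma> (train d)"
  "calib (permute_data \<sigma> d) = permute \<sigma> (calib d)"
  by (simp_all add: permute_data_def)

lemma V_array_permute_data: "V_array (permute_data \<sigma> d) = permute \<sigma> (V_array d)"
  by (auto simp: V_array_def permute_def fun_eq_iff)

lemma X_array_permute_data: "X_array (permute_data \<sigma> d) = permute \<sigma> (X_array d)"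
  by (auto simp: X_array_def permute_def fun_eq_iff)

text \<open>The condition inside \<open>permutation_invariant_model\<close>, for one permutation and
  one realisation. Either alternative of the hypothesis on the model supplies it almost surely for
  permutations of \<open>B\<close>.\<close>

definition equivariant_fit where
  "equivariant_fit \<zeta> \<mu> \<sigma> d \<longleftrightarrow>
     permute \<sigma> (mu_split \<zeta> \<mu> d) =
     fitted \<mu> (I_split (permute \<sigma> (X_array d)) (permute \<sigma> (Z_array \<zeta> (X_array d))) (permute \<sigma> (calib d)))
       (T_split (permute \<sigma> (V_array d)) (permute \<sigma> (Z_array \<zeta> (X_array d))) (permute \<sigma> (train d)))"

text \<open>Refitting on relabelled data recomputes the summaries from the relabelled covariates.
  The first assumption identifies them with the relabelled summaries, which are the ones
  \<open>equivariant_fit\<close> refers to.\<close>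

lemma mu_split_permute_data:
  assumes "permute \<sigma> (Z_array \<zeta> (X_array d)) = Z_array \<zeta> (permute \<sigma> (X_array d))"
    and "equivariant_fit \<zeta> \<mu> \<sigma> d"
  shows "mu_split \<zeta> \<mu> (permute_data \<sigma> d) = permute \<sigma> (mu_split \<zeta> \<mu> d)"
  using assms by (simp add: equivariant_fit_def mu_split_def X_array_permute_data V_array_permute_data)

lemma calib_index_permute:
  assumes "bij \<sigma>"
  shows "calib_index (permute \<sigma> S) (permute \<sigma> m) i r = calib_index S m (\<sigma> i) (\<sigma> r)"
proof -
  have bij: "bij_betw \<sigma> {j. m (\<sigma> j, \<sigma> r)} {j. m (j, \<sigma> r)}"
    using assms by (auto simp: bij_betw_def inj_on_def bij_def image_iff)
  show ?thesis
    unfolding calib_index_def permute_def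
    by (simp add: sum.reindex_bij_betw[OF bij, symmetric] bij_betw_same_card[OF bij])
qed

lemma C_index_permute_data:
  assumes "bij \<sigma>"
    and "permute \<sigma> (Z_array \<zeta> (X_array d)) = Z_array \<zeta> (permute \<sigma> (X_array d))"
    and "equivariant_fit \<zeta> \<mu> \<sigma> d"
  shows "C_index \<zeta> \<mu> s (permute_data \<sigma> d) i r = C_index \<zeta> \<mu> s d (\<sigma> i) (\<sigma> r)"
proof -
  have "score \<zeta> \<mu> s (permute_data \<sigma> d) = permute \<sigma> (score \<zeta> \<mu> s d)"
    by (auto simp: score_def mu_split_permute_data[OF assms(2,3)] permute_def)
  thus ?thesis by (simp add: C_index_def calib_index_permute[OF assms(1)])
qed

section \<open>Nodal ranks, the selected node and its calibration neighbours\<close>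

lemma Z_hat_permute_data:
  assumes "permute \<sigma> (Z_array \<zeta> (X_array d)) = Z_array \<zeta> (permute \<sigma> (X_array d))"
  shows "Z_hat \<zeta> h (permute_data \<sigma> d) = Z_hat \<zeta> h d \<circ> \<sigma>"
proof
  fix i
  \<comment> \<open>The assumption concerns the pair array only; its diagonal entries give back the
    node-level summaries.\<close>
  have "fst (Z_array \<zeta> (permute \<sigma> (X_array d)) (i, i)) = fst (permute \<sigma> (Z_array \<zeta> (X_array d)) (i, i))"
    using assms by simp
  thus "Z_hat \<zeta> h (permute_data \<sigma> d) i = (Z_hat \<zeta> h d \<circ> \<sigma>) i"
    by (simp add: Z_hat_def X_array_permute_data Z_array_def permute_def)
qed

lemma rank_of_comp:
  assumes "bij \<sigma>"
  shows "rank_of (z \<circ> \<sigma>) r = rank_of z (\<sigma> r)"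
proof -
  have bij: "bij_betw \<sigma> {j. z (\<sigma> j) \<le> z (\<sigma> r)} {j. z j \<le> z (\<sigma> r)}"
    using assms by (auto simp: bij_betw_def inj_on_def bij_def image_iff)
  show ?thesis using bij_betw_same_card[OF bij] by (simp add: rank_of_def)
qed

text \<open>Sublevel sets of \<open>z\<close> are nested, so two of them with equal finite
  cardinality coincide; hence equal ranks force equal values.\<close>

lemma rank_of_inj:
  fixes z :: "'n::finite \<Rightarrow> real"
  assumes "inj z" "rank_of z a = rank_of z b"
  shows "a = b"
proof -
  have *: "z y \<le> z x" if "z x \<le> z y" "rank_of z x = rank_of z y" for x y
  proof -
    have "{j. z j \<le> z x} = {j. z j \<le> z y}"
      using that by (intro card_subset_eq) (auto simp: rank_of_def)
    thus ?thesis by auto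
  qed
  have "z a = z b" using *[of a b] *[of b a] assms(2) by linarith
  thus ?thesis using assms(1) by (simp add: inj_eq)
qed

lemma selected_node_comp:
  fixes z :: "'n::finite \<Rightarrow> real"
  assumes "bij \<sigma>" "\<sigma> r = r" "inj z"
  shows "selected_node k (z \<circ> \<sigma>) = r \<longleftrightarrow> selected_node k z = r"
proof (cases "\<exists>a. rank_of z a = k")
  case True
  then obtain a where a: "rank_of z a = k" by blast
  have uniq: "b = a" if "rank_of z b = k" for b
    using rank_of_inj[OF assms(3)] that a by simp
  have "selected_node k z = a"
    unfolding selected_node_def using a uniq by (rule the_equality)
  moreover have "selected_node k (z \<circ> \<sigma>) = inv \<sigma> a"
    unfolding selected_node_def rank_of_comp[OF assms(1)]
  proof (rule the_equality)
    show "rank_of z (\<sigma> (inv \<sigma> a)) = k"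
      using a assms(1) by (simp add: bij_is_surj surj_f_inv_f)
    show "b = inv \<sigma> a" if "rank_of z (\<sigma> b) = k" for b
      using uniq[OF that] assms(1) by (metis bij_inv_eq_iff)
  qed
  moreover have "inv \<sigma> a = r \<longleftrightarrow> a = r"
    using assms(1,2) by (metis bij_inv_eq_iff)
  ultimately show ?thesis by simp
next
  \<comment> \<open>No node has rank \<open>k\<close>, before or after relabelling. Both
    descriptions range over the empty predicate and denote the same unspecified node.\<close>
  case False
  thus ?thesis by (simp add: selected_node_def rank_of_comp[OF assms(1)])
qed

lemma calib_nbrs_permute_data:
  assumes "\<sigma> permutes B" "r \<notin> B"
  shows "calib_nbrs (permute_data \<sigma> d) r = B \<longleftrightarrow> calib_nbrs d r = B"
proof -
  have r: "\<sigma> r = r" using assms by (simp add: permutes_not_in)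
  have "calib_nbrs (permute_data \<sigma> d) r = \<sigma> -` calib_nbrs d r"
    by (simp add: calib_nbrs_def permute_def r vimage_def)
  moreover have "\<sigma> -` N = B \<longleftrightarrow> N = B" for N
  proof
    assume "\<sigma> -` N = B"
    hence "\<sigma> ` B = N" using surj_image_vimage_eq[OF permutes_surj[OF assms(1)], of N] by simp
    thus "N = B" using permutes_image[OF assms(1)] by simp
  qed (simp add: permutes_vimage[OF assms(1)])
  ultimately show ?thesis by simp
qed

text \<open>\<open>\<sigma>\<close> fixes \<open>D1\<close> pointwise, so the training family is
  literally unchanged. The fitted function is then the same, and it is evaluated entry by entry, so
  relabelling its inputs relabels its outputs.\<close>

lemma equivariant_fit_node_splitting:
  assumes "\<sigma> permutes B" "B \<inter> D1 = {}"
    and "\<And>i j. train d (i, j) \<Longrightarrow> i \<in> D1 \<and> j \<in> D1"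
  shows "equivariant_fit \<zeta> \<mu> \<sigma> d"
proof -
  have fix1: "\<sigma> a = a" if "a \<in> D1" for a
    using assms(1,2) that by (meson disjoint_iff permutes_not_in)
  \<comment> \<open>If \<open>\<sigma> a\<close> lies in \<open>D1\<close> it is a fixed point, and
    injectivity gives \<open>\<sigma> a = a\<close>: nothing enters \<open>D1\<close> from
    outside.\<close>
  have mem: "a \<in> D1" if "\<sigma> a \<in> D1" for a
    using injD[OF permutes_inj[OF assms(1)] fix1[OF that]] that by simp
  have T: "T_split (permute \<sigma> v) (permute \<sigma> z) (permute \<sigma> (train d)) = T_split v z (train d)" for v z
  proof (rule ext, clarify)
    fix a b
    have "train d (\<sigma> a, \<sigma> b) \<longleftrightarrow> train d (a, b)"
      using assms(3) fix1 mem by metis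
    moreover have "\<sigma> a = a \<and> \<sigma> b = b" if "train d (a, b)"
      using assms(3)[OF that] fix1 by blast
    ultimately show "T_split (permute \<sigma> v) (permute \<sigma> z) (permute \<sigma> (train d)) (a, b) = T_split v z (train d) (a, b)"
      by (simp add: T_split_def permute_def)
  qed
  show ?thesis
    unfolding equivariant_fit_def T
    by (auto simp: mu_split_def fitted_def I_split_def permute_def)
qed

subsection \<open>Counting\<close>

text \<open>Every member of the set scores at least as much as its lowest scorer \<open>a\<close>,
  so all of them are counted in the index of \<open>a\<close>, which is at most \<open>t\<close>.
  Ties cause no loss because the index counts with a weak inequality.\<close>

lemma card_calib_index_le:
  fixes S :: "'n::finite \<times> 'n \<Rightarrow> real"
  assumes "{j. m (j, r)} = B" "0 \<le> t"
  shows "real (card {j\<in>B. calib_index S m j r \<le> t}) \<le> t * real (card B)"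
proof (cases "{j\<in>B. calib_index S m j r \<le> t} = {}")
  case True
  thus ?thesis using assms(2) by (simp only: True) simp
next
  case False
  let ?G = "{j\<in>B. calib_index S m j r \<le> t}"
  define a where "a = arg_min_on (\<lambda>j. S (j, r)) ?G"
  have aG: "a \<in> ?G" unfolding a_def using False by (intro arg_min_if_finite(1)) auto
  have le: "S (a, r) \<le> S (j, r)" if "j \<in> ?G" for j
    unfolding a_def using False that by (intro arg_min_least) auto
  have "m (a, r)" using aG assms(1) by auto
  have B0: "card B > 0" using aG by (auto simp: card_gt_0_iff)
  have "real (card ?G) \<le> real (card {j\<in>B. S (a, r) \<le> S (j, r)})"
    using le by (intro of_nat_mono card_mono) auto
  also have "\<dots> = (\<Sum>j\<in>B. of_bool (S (j, r) \<ge> S (a, r) \<and> m (a, r)))"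
    using \<open>m (a, r)\<close> by (simp add: Int_def)
  also have "\<dots> = calib_index S m a r * real (card B)"
    using B0 assms(1) by (simp add: calib_index_def)
  also have "\<dots> \<le> t * real (card B)"
    using aG by (intro mult_right_mono) auto
  finally show ?thesis .
qed

subsection \<open>Measurability\<close>

lemma measurable_Some_option_measure [measurable]: "Some \<in> measurable N (option_measure N)"
  unfolding option_measure_def
proof (rule measurable_measure_of)
  show "insert {None} ((`) Some ` sets N) \<subseteq> Pow (insert None (Some ` space N))"
    using sets.sets_into_space by blast
  show "Some \<in> space N \<rightarrow> insert None (Some ` space N)" by auto
  fix A assume "A \<in> insert {None} ((`) Some ` sets N)"
  then consider "A = {None}" | C where "C \<in> sets N" "A = Some ` C" by blast
  thus "Some -` A \<inter> space N \<in> sets N"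
  proof cases
    case 1
    hence "Some -` A = {}" by auto
    thus ?thesis by simp
  next
    case 2
    hence "Some -` A = C" by (simp add: inj_vimage_image_eq)
    thus ?thesis using 2(1) by auto
  qed
qed

lemma None_in_space_option_measure [simp]: "None \<in> space (option_measure N)"
proof -
  have "insert {None} ((`) Some ` sets N) \<subseteq> Pow (insert None (Some ` space N))"
    using sets.sets_into_space by blast
  thus ?thesis by (simp add: option_measure_def space_measure_of)
qed

text \<open>Each fibre is a finite intersection of membership events and their complements.\<close>

lemma measurable_finite_set:
  fixes F :: "'a \<Rightarrow> 'c::finite set"
  assumes [measurable]: "\<And>c. Measurable.pred Q (\<lambda>\<omega>. c \<in> F \<omega>)"
  shows "F \<in> measurable Q (count_space UNIV)"
proof (rule measurable_count_space_eq2[THEN iffD2])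
  show "F \<in> space Q \<rightarrow> UNIV \<and> (\<forall>A\<in>UNIV. F -` {A} \<inter> space Q \<in> sets Q)"
  proof (intro conjI ballI)
    fix A :: "'c set"
    have "F -` {A} \<inter> space Q = {\<omega>\<in>space Q. \<forall>c. c \<in> F \<omega> \<longleftrightarrow> c \<in> A}" by auto
    also have "\<dots> \<in> sets Q" by measurable
    finally show "F -` {A} \<inter> space Q \<in> sets Q" .
  qed auto
qed auto

lemma random_dyadic_data_permute_data:
  "random_dyadic_data Q MX ME D \<Longrightarrow> random_dyadic_data Q MX ME (\<lambda>\<omega>. permute_data \<sigma> (D \<omega>))"
  by (simp add: random_dyadic_data_def permute_def case_prod_beta)

text \<open>Rebuilds the record from the tuple whose law is assumed invariant, reading node
  covariates off the diagonal. Events about the record thereby become sets of tuples.\<close>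

definition of_arrays where
  "of_arrays = (\<lambda>(v, m, m1, m2).
     \<lparr>resp = \<lambda>p. fst (v p), node_cov = \<lambda>i. fst (snd (v (i, i))),
      edge_cov = \<lambda>p. snd (snd (snd (v p))), sampled = m, train = m1, calib = m2\<rparr>)"

abbreviation data_space :: "'x measure \<Rightarrow> 'e measure \<Rightarrow> (('n \<times> 'n \<Rightarrow> real \<times> 'x \<times> 'x \<times> 'e) \<times>
     ('n \<times> 'n \<Rightarrow> bool) \<times> ('n \<times> 'n \<Rightarrow> bool) \<times> ('n \<times> 'n \<Rightarrow> bool)) measure" where
  "data_space MX ME \<equiv> arrays (V_entry MX ME) \<Otimes>\<^sub>M arrays (count_space UNIV) \<Otimes>\<^sub>M
     arrays (count_space UNIV) \<Otimes>\<^sub>M arrays (count_space UNIV)"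

lemma of_arrays_V_array [simp]:
  fixes d :: "('n, 'x, 'e) dyadic_data"
  shows "of_arrays (V_array d, sampled d, train d, calib d) = d"
  by (cases d) (simp add: of_arrays_def V_array_def case_prod_beta)

text \<open>Makes the tuple space itself a sample space carrying data, so that the measurability
  results below also apply to sets of tuples.\<close>

lemma random_dyadic_data_of_arrays:
  "random_dyadic_data (data_space MX ME :: (('n \<times> 'n \<Rightarrow> _) \<times> _) measure) MX ME of_arrays"
proof -
  let ?L = "data_space MX ME :: (('n \<times> 'n \<Rightarrow> _) \<times> _) measure"
  have comp: "(\<lambda>w. f w p) \<in> measurable L N" if "f \<in> measurable L (arrays N)" for f p L N
    using measurable_compose[OF that measurable_component_singleton] by simp
  have V: "(\<lambda>w. fst w p) \<in> measurable ?L (V_entry MX ME)" for p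
    by (rule comp) (rule measurable_fst)
  have "(\<lambda>w. fst (fst w p)) \<in> borel_measurable ?L"
    "(\<lambda>w. fst (snd (fst w p))) \<in> measurable ?L MX"
    "(\<lambda>w. snd (snd (snd (fst w p)))) \<in> measurable ?L ME" for p
    using V[of p] unfolding V_entry_def
    by (auto intro: measurable_fst'' measurable_snd'')
  moreover have "(\<lambda>w. fst (snd w) p) \<in> measurable ?L (count_space UNIV)"
    "(\<lambda>w. fst (snd (snd w)) p) \<in> measurable ?L (count_space UNIV)"
    "(\<lambda>w. snd (snd (snd w)) p) \<in> measurable ?L (count_space UNIV)" for p
    by (rule comp, intro measurable_fst'' measurable_snd'' measurable_ident_sets refl)+
  ultimately show ?thesis
    unfolding random_dyadic_data_def of_arrays_def case_prod_beta by simp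
qed

section \<open>Measurability of scores, indices and selection\<close>

locale dyadic_sample =
  fixes Q :: "'a measure" and MX :: "'x measure" and ME :: "'e measure"
    and D :: "'a \<Rightarrow> ('n::finite, 'x, 'e) dyadic_data"
  assumes data: "random_dyadic_data Q MX ME D"
begin

lemma measurable_data [measurable]:
  "(\<lambda>\<omega>. resp (D \<omega>) p) \<in> borel_measurable Q"
  "(\<lambda>\<omega>. node_cov (D \<omega>) i) \<in> measurable Q MX"
  "(\<lambda>\<omega>. edge_cov (D \<omega>) p) \<in> measurable Q ME"
  "Measurable.pred Q (\<lambda>\<omega>. sampled (D \<omega>) p)"
  "Measurable.pred Q (\<lambda>\<omega>. train (D \<omega>) p)"
  "Measurable.pred Q (\<lambda>\<omega>. calib (D \<omega>) p)"
  using data unfolding random_dyadic_data_def by blast+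

lemma measurable_V_array [measurable]: "(\<lambda>\<omega>. V_array (D \<omega>) p) \<in> measurable Q (V_entry MX ME)"
  unfolding V_array_def V_entry_def case_prod_beta by measurable

lemma measurable_X_array [measurable]: "(\<lambda>\<omega>. X_array (D \<omega>) p) \<in> measurable Q (X_entry MX ME)"
  unfolding X_array_def X_entry_def case_prod_beta by measurable

lemma measurable_X_arrays [measurable]: "(\<lambda>\<omega>. X_array (D \<omega>)) \<in> measurable Q (arrays (X_entry MX ME))"
  by (rule measurable_abs_UNIV) measurable

lemma measurable_arrays [measurable]:
  "(\<lambda>\<omega>. (V_array (D \<omega>), sampled (D \<omega>), train (D \<omega>), calib (D \<omega>))) \<in> measurable Q (data_space MX ME)"
  by (intro measurable_Pair measurable_abs_UNIV; measurable)

end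

text \<open>Sample space and data are parameters so that one measurability proof serves the original
  data, the permuted data and the tuple space with \<open>of_arrays\<close>.\<close>

locale dyadic_model = dyadic_sample Q MX ME D
  for Q :: "'a measure" and MX :: "'x measure" and ME :: "'e measure"
    and D :: "'a \<Rightarrow> ('n::finite, 'x, 'e) dyadic_data" +
  fixes MZn :: "'zn measure" and MZp :: "'zp measure"
    and \<zeta> :: "('n \<times> 'n \<Rightarrow> 'x \<times> 'x \<times> 'e \<times> bool) \<Rightarrow> ('n \<Rightarrow> 'zn) \<times> ('n \<times> 'n \<Rightarrow> 'zp)"
    and \<mu> :: "('x \<times> 'x \<times> 'e \<times> bool) \<times> ('zn \<times> 'zn \<times> 'zp) \<times> bool \<Rightarrow>
              ('n \<times> 'n \<Rightarrow> ((real \<times> 'x \<times> 'x \<times> 'e) \<times> ('zn \<times> 'zn \<times> 'zp)) option) \<Rightarrow> real"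
    and s :: "real \<times> real \<Rightarrow> real" and h :: "'zn \<Rightarrow> real"
  assumes zeta_meas [measurable]:
      "\<zeta> \<in> measurable (arrays (X_entry MX ME)) (Pi\<^sub>M UNIV (\<lambda>_. MZn) \<Otimes>\<^sub>M arrays MZp)"
    and mu_meas: "(\<lambda>(a, T). \<mu> a T) \<in> borel_measurable
          ((X_entry MX ME \<Otimes>\<^sub>M Z_entry MZn MZp \<Otimes>\<^sub>M count_space UNIV) \<Otimes>\<^sub>M
           arrays (option_measure (V_entry MX ME \<Otimes>\<^sub>M Z_entry MZn MZp)))"
    and s_meas [measurable]: "s \<in> borel_measurable borel"
    and h_meas [measurable]: "h \<in> borel_measurable MZn"
begin

lemma measurable_node_summary [measurable]:
  "(\<lambda>\<omega>. fst (\<zeta> (X_array (D \<omega>))) i) \<in> measurable Q MZn"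
  by measurable

lemma measurable_Z_array [measurable]:
  "(\<lambda>\<omega>. Z_array \<zeta> (X_array (D \<omega>)) p) \<in> measurable Q (Z_entry MZn MZp)"
  unfolding Z_array_def Z_entry_def case_prod_beta by measurable

lemma measurable_T_split:
  "(\<lambda>\<omega>. T_split (V_array (D \<omega>)) (Z_array \<zeta> (X_array (D \<omega>))) (train (D \<omega>)))
     \<in> measurable Q (arrays (option_measure (V_entry MX ME \<Otimes>\<^sub>M Z_entry MZn MZp)))"
proof (rule measurable_abs_UNIV)
  fix p
  let ?O = "option_measure (V_entry MX ME \<Otimes>\<^sub>M Z_entry MZn MZp)"
  have "(\<lambda>\<omega>. Some (V_array (D \<omega>) p, Z_array \<zeta> (X_array (D \<omega>)) p)) \<in> measurable Q ?O"
    by (rule measurable_compose[OF _ measurable_Some_option_measure]) measurable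
  moreover have "(\<lambda>\<omega>. None) \<in> measurable Q ?O" by simp
  moreover have "{\<omega> \<in> space Q. train (D \<omega>) p} \<in> sets Q" by measurable
  ultimately show "(\<lambda>\<omega>. T_split (V_array (D \<omega>)) (Z_array \<zeta> (X_array (D \<omega>))) (train (D \<omega>)) p)
      \<in> measurable Q ?O"
    unfolding T_split_def by (rule measurable_If)
qed

lemma measurable_score [measurable]:
  "(\<lambda>\<omega>. score \<zeta> \<mu> s (D \<omega>) p) \<in> borel_measurable Q"
proof -
  have I: "(\<lambda>\<omega>. I_split (X_array (D \<omega>)) (Z_array \<zeta> (X_array (D \<omega>))) (calib (D \<omega>)) p) \<in>
      measurable Q (X_entry MX ME \<Otimes>\<^sub>M Z_entry MZn MZp \<Otimes>\<^sub>M count_space UNIV)"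
    unfolding I_split_def by measurable
  have [measurable]: "(\<lambda>\<omega>. mu_split \<zeta> \<mu> (D \<omega>) p) \<in> borel_measurable Q"
    using measurable_compose[OF measurable_Pair[OF I measurable_T_split] mu_meas]
    by (simp add: mu_split_def fitted_def)
  show ?thesis unfolding score_def by measurable
qed

lemma measurable_C_index [measurable]:
  "(\<lambda>\<omega>. C_index \<zeta> \<mu> s (D \<omega>) i r) \<in> borel_measurable Q"
proof -
  \<comment> \<open>The random index set is moved into indicators, leaving sums over the fixed
    finite type.\<close>
  have eq: "C_index \<zeta> \<mu> s (D \<omega>) i r =
     1 / (\<Sum>j\<in>UNIV. of_bool (calib (D \<omega>) (j, r))) *
     (\<Sum>j\<in>UNIV. of_bool (calib (D \<omega>) (j, r) \<and> score \<zeta> \<mu> s (D \<omega>) (j, r) \<ge> score \<zeta> \<mu> s (D \<omega>) (i, r) \<and>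
        calib (D \<omega>) (i, r)))" for \<omega>
    unfolding C_index_def calib_index_def
    by (auto simp: Int_def conj_ac)
  show ?thesis unfolding eq of_bool_def by measurable
qed

lemma measurable_calib_nbrs [measurable]:
  "(\<lambda>\<omega>. calib_nbrs (D \<omega>) r) \<in> measurable Q (count_space UNIV)"
  by (rule measurable_finite_set) (simp add: calib_nbrs_def)

lemma measurable_selected_node [measurable]:
  "(\<lambda>\<omega>. selected_node k (Z_hat \<zeta> h (D \<omega>))) \<in> measurable Q (count_space UNIV)"
proof -
  have [measurable]: "(\<lambda>\<omega>. Z_hat \<zeta> h (D \<omega>) j) \<in> borel_measurable Q" for j
    unfolding Z_hat_def by measurable
  \<comment> \<open>The selected node depends on the statistics only through their order relation, a
    random element of a finite discrete space on which every function is measurable.\<close>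
  have "(\<lambda>\<omega>. {(j, l). Z_hat \<zeta> h (D \<omega>) j \<le> Z_hat \<zeta> h (D \<omega>) l}) \<in> measurable Q (count_space UNIV)"
    by (rule measurable_finite_set) (simp add: case_prod_beta)
  from measurable_compose[OF this, of "\<lambda>G. THE r. card {j. (j, r) \<in> G} = k" "count_space UNIV"]
  show ?thesis by (simp add: selected_node_def rank_of_def)
qed

end

text \<open>Since \<open>of_arrays\<close> inverts the passage from records to tuples, the event is
  the preimage of a set of tuples, and the equality of laws applies to that set.\<close>

lemma distr_permute_data:
  fixes D :: "'a \<Rightarrow> ('n::finite, 'x, 'e) dyadic_data"
  assumes data: "random_dyadic_data P MX ME D"
    and exch: "exchangeable_splitting P MX ME D"
    and \<sigma>: "\<sigma> permutes active_nodes P D"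
    and Q: "{w \<in> space (data_space MX ME). R (of_arrays w :: ('n, 'x, 'e) dyadic_data)} \<in> sets (data_space MX ME)"
  shows "\<P>(\<omega> in P. R (permute_data \<sigma> (D \<omega>))) = \<P>(\<omega> in P. R (D \<omega>))"
proof -
  let ?L = "data_space MX ME :: (('n \<times> 'n \<Rightarrow> _) \<times> _) measure" and ?A = "{w \<in> space (data_space MX ME). R (of_arrays w)}"
  define W where "W d = (V_array d, sampled d, train d, calib d)" for d :: "('n, 'x, 'e) dyadic_data"
  have meas: "(\<lambda>\<omega>. W (F \<omega>)) \<in> measurable P ?L" if "random_dyadic_data P MX ME F" for F
    unfolding W_def using that by (intro dyadic_sample.measurable_arrays dyadic_sample.intro)
  have eq: "distr P ?L (\<lambda>\<omega>. W (permute_data \<sigma> (D \<omega>))) = distr P ?L (\<lambda>\<omega>. W (D \<omega>))"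
    using exch \<sigma> by (simp add: exchangeable_splitting_def Let_def W_def V_array_permute_data)
  have "\<P>(\<omega> in P. R (F \<omega>)) = measure (distr P ?L (\<lambda>\<omega>. W (F \<omega>))) ?A"
    if F: "random_dyadic_data P MX ME F" for F
  proof -
    have "(\<lambda>\<omega>. W (F \<omega>)) -` ?A \<inter> space P = {\<omega> \<in> space P. R (F \<omega>)}"
      using measurable_space[OF meas[OF F]] by (auto simp: W_def)
    thus ?thesis by (simp add: measure_distr[OF meas[OF F] Q])
  qed
  from this[OF data] this[OF random_dyadic_data_permute_data[OF data]] eq show ?thesis by simp
qed

section \<open>The conditional bound for the calibration index\<close>

theorem theorem4p4:
  fixes P :: "'a measure"
    and D :: "'a \<Rightarrow> ('n::finite, 'x, 'e) dyadic_data"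
    and MX :: "'x measure" and ME :: "'e measure"
    and MZn :: "'zn measure" and MZp :: "'zp measure"
    and \<zeta> :: "('n \<times> 'n \<Rightarrow> 'x \<times> 'x \<times> 'e \<times> bool) \<Rightarrow> ('n \<Rightarrow> 'zn) \<times> ('n \<times> 'n \<Rightarrow> 'zp)"
    and \<mu> :: "('x \<times> 'x \<times> 'e \<times> bool) \<times> ('zn \<times> 'zn \<times> 'zp) \<times> bool \<Rightarrow>
              ('n \<times> 'n \<Rightarrow> ((real \<times> 'x \<times> 'x \<times> 'e) \<times> ('zn \<times> 'zn \<times> 'zp)) option) \<Rightarrow> real"
    and s :: "real \<times> real \<Rightarrow> real"
    and h :: "'zn \<Rightarrow> real"
    and k :: nat and B :: "'n set" and i r :: 'n and t :: real
  assumes prob: "prob_space P"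
    and data: "random_dyadic_data P MX ME D"
    and zeta_meas: "\<zeta> \<in> measurable (arrays (X_entry MX ME)) (Pi\<^sub>M UNIV (\<lambda>_. MZn) \<Otimes>\<^sub>M arrays MZp)"
    and mu_meas: "(\<lambda>(a, T). \<mu> a T) \<in> borel_measurable
          ((X_entry MX ME \<Otimes>\<^sub>M Z_entry MZn MZp \<Otimes>\<^sub>M count_space UNIV) \<Otimes>\<^sub>M
           arrays (option_measure (V_entry MX ME \<Otimes>\<^sub>M Z_entry MZn MZp)))"
    and s_meas: "s \<in> borel_measurable borel"
    and h_meas: "h \<in> borel_measurable MZn"
    and exch: "exchangeable_splitting P MX ME D"
    and netcov: "network_covariates P \<zeta> D"
    and model: "deterministic_node_splitting P D \<or> permutation_invariant_model P \<zeta> \<mu> D"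
    and no_ties: "AE \<omega> in P. inj (Z_hat \<zeta> h (D \<omega>))"
    and k: "1 \<le> k" "k \<le> CARD('n)"
    and i: "i \<in> B"
    and no_self_pair: "r \<notin> B"
    and t: "0 \<le> t" "t \<le> 1"
  shows "\<P>(\<omega> in P. C_index \<zeta> \<mu> s (D \<omega>) i r \<le> t \<bar>
            selected_node k (Z_hat \<zeta> h (D \<omega>)) = r \<and> calib_nbrs (D \<omega>) r = B) \<le> t"
proof -
  interpret prob_space P by (rule prob)
  interpret dyadic_model P MX ME D MZn MZp \<zeta> \<mu> s h
    by unfold_locales (fact data zeta_meas mu_meas s_meas h_meas)+
  interpret L: dyadic_model "data_space MX ME" MX ME of_arrays MZn MZp \<zeta> \<mu> s h
    by unfold_locales (fact random_dyadic_data_of_arrays zeta_meas mu_meas s_meas h_meas)+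
  define E where "E d \<longleftrightarrow> selected_node k (Z_hat \<zeta> h d) = r \<and> calib_nbrs d r = B"
    for d :: "('n, 'x, 'e) dyadic_data"
  define c where "c j d = C_index \<zeta> \<mu> s d j r" for j d
  have [measurable]: "Measurable.pred P (\<lambda>\<omega>. E (D \<omega>))" "(\<lambda>\<omega>. c j (D \<omega>)) \<in> borel_measurable P" for j
    unfolding E_def c_def by measurable
  have [measurable]: "Measurable.pred (data_space MX ME) (\<lambda>w. E (of_arrays w))"
    "(\<lambda>w. c j (of_arrays w)) \<in> borel_measurable (data_space MX ME)" for j
    unfolding E_def c_def by measurable
  have "prob {\<omega> \<in> space P. c i (D \<omega>) \<le> t \<and> E (D \<omega>)} \<le> t * prob {\<omega> \<in> space P. E (D \<omega>)}"
  proof (cases "prob {\<omega> \<in> space P. E (D \<omega>)} = 0")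
    case True
    have "prob {\<omega> \<in> space P. c i (D \<omega>) \<le> t \<and> E (D \<omega>)} \<le> prob {\<omega> \<in> space P. E (D \<omega>)}"
      by (rule finite_measure_mono) auto
    with True show ?thesis by simp
  next
    case False
    hence pos: "prob {\<omega> \<in> space P. E (D \<omega>)} > 0" by (simp add: zero_less_measure_iff)
    \<comment> \<open>An event of positive probability meets every almost sure property; a single
      such outcome suffices to derive facts about non-random sets.\<close>
    have witness: "\<exists>\<omega>. E (D \<omega>) \<and> R \<omega>" if "AE \<omega> in P. R \<omega>" for R
    proof (rule ccontr)
      assume "\<nexists>\<omega>. E (D \<omega>) \<and> R \<omega>"
      with that have "AE \<omega> in P. \<not> E (D \<omega>)" by (auto elim: eventually_mono)
      hence "prob {\<omega> \<in> space P. E (D \<omega>)} = 0" by (subst prob_eq_0) auto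
      with pos show False by simp
    qed
    \<comment> \<open>On the conditioning event every \<open>j\<close> in \<open>B\<close> forms a
      calibration pair with \<open>r\<close>, so permutations of \<open>B\<close> are among those
      covered by exchangeability.\<close>
    have "B \<subseteq> active_nodes P D"
    proof
      fix j assume "j \<in> B"
      hence "prob {\<omega> \<in> space P. E (D \<omega>)} \<le> \<P>(\<omega> in P. \<exists>l. calib (D \<omega>) (j, l) \<or> calib (D \<omega>) (l, j))"
        by (intro finite_measure_mono) (auto simp: E_def calib_nbrs_def)
      with pos show "j \<in> active_nodes P D" by (simp add: active_nodes_def)
    qed
    have fit: "AE \<omega> in P. equivariant_fit \<zeta> \<mu> \<sigma> (D \<omega>)" if \<sigma>: "\<sigma> permutes B" for \<sigma>
      using model
    proof
      assume "deterministic_node_splitting P D"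
      then obtain D1 D2 where D: "D1 \<inter> D2 = {}" and
        split: "AE \<omega> in P. \<forall>i j.
           (train (D \<omega>) (i, j) \<longleftrightarrow> sampled (D \<omega>) (i, j) \<and> i \<in> D1 \<and> j \<in> D1) \<and>
           (calib (D \<omega>) (i, j) \<longleftrightarrow> sampled (D \<omega>) (i, j) \<and> i \<in> D2 \<and> j \<in> D2)"
        by (auto simp: deterministic_node_splitting_def)
      have "B \<subseteq> D2" using witness[OF split] by (auto simp: E_def calib_nbrs_def)
      hence "B \<inter> D1 = {}" using D by blast
      with split show ?thesis
        by (auto elim!: eventually_mono intro: equivariant_fit_node_splitting[OF \<sigma>])
    next
      assume "permutation_invariant_model P \<zeta> \<mu> D"
      thus ?thesis
        using permutes_subset[OF \<sigma> subset_UNIV]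
        by (simp add: permutation_invariant_model_def equivariant_fit_def Let_def)
    qed
    have exchangeable: "prob {\<omega> \<in> space P. c j (D \<omega>) \<le> t \<and> E (D \<omega>)} =
        prob {\<omega> \<in> space P. c i (D \<omega>) \<le> t \<and> E (D \<omega>)}" if j: "j \<in> B" for j
    proof -
      \<comment> \<open>Swapping \<open>i\<close> and \<open>j\<close> turns the index of
        \<open>i\<close> on the permuted data into the index of \<open>j\<close> on the original
        data.\<close>
      define \<sigma> where "\<sigma> = Transposition.transpose i j"
      have \<sigma>: "\<sigma> permutes B" unfolding \<sigma>_def using i j by (rule permutes_swap_id)
      have bij: "bij \<sigma>" using \<sigma> by (rule permutes_bij)
      have r: "\<sigma> r = r" using \<sigma> no_self_pair by (simp add: permutes_not_in)
      have "AE \<omega> in P. permute \<sigma> (Z_array \<zeta> (X_array (D \<omega>))) = Z_array \<zeta> (permute \<sigma> (X_array (D \<omega>)))"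
        using netcov permutes_subset[OF \<sigma> subset_UNIV] by (simp add: network_covariates_def)
      with fit[OF \<sigma>] no_ties
      have ae: "AE \<omega> in P. (c i (permute_data \<sigma> (D \<omega>)) \<le> t \<and> E (permute_data \<sigma> (D \<omega>))) \<longleftrightarrow>
          (c j (D \<omega>) \<le> t \<and> E (D \<omega>))"
      proof eventually_elim
        case (elim \<omega>)
        have "c i (permute_data \<sigma> (D \<omega>)) = c j (D \<omega>)"
          using C_index_permute_data[OF bij elim(3,1)] by (simp add: c_def r) (simp add: \<sigma>_def)
        moreover have "E (permute_data \<sigma> (D \<omega>)) \<longleftrightarrow> E (D \<omega>)"
          unfolding E_def Z_hat_permute_data[OF elim(3)] selected_node_comp[OF bij r elim(2)]
            calib_nbrs_permute_data[OF \<sigma> no_self_pair] ..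
        ultimately show ?case by simp
      qed
      have law: "prob {\<omega> \<in> space P. c i (permute_data \<sigma> (D \<omega>)) \<le> t \<and> E (permute_data \<sigma> (D \<omega>))} =
          prob {\<omega> \<in> space P. c i (D \<omega>) \<le> t \<and> E (D \<omega>)}"
        using permutes_subset[OF \<sigma> \<open>B \<subseteq> active_nodes P D\<close>]
        by (intro distr_permute_data[OF data exch, where R = "\<lambda>d. c i d \<le> t \<and> E d"]) measurable
      \<comment> \<open>Comparing probabilities of almost surely equal events requires the event of
        the permuted data to be measurable as well.\<close>
      interpret D\<sigma>: dyadic_model P MX ME "\<lambda>\<omega>. permute_data \<sigma> (D \<omega>)" MZn MZp \<zeta> \<mu> s h
        by unfold_locales (fact random_dyadic_data_permute_data[OF data] zeta_meas mu_meas s_meas h_meas)+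
      have "{\<omega> \<in> space P. c i (permute_data \<sigma> (D \<omega>)) \<le> t \<and> E (permute_data \<sigma> (D \<omega>))} \<in> events"
        unfolding c_def E_def by measurable
      with ae have "prob {\<omega> \<in> space P. c i (permute_data \<sigma> (D \<omega>)) \<le> t \<and> E (permute_data \<sigma> (D \<omega>))} =
          prob {\<omega> \<in> space P. c j (D \<omega>) \<le> t \<and> E (D \<omega>)}"
        by (intro finite_measure_eq_AE) auto
      with law show ?thesis by simp
    qed
    \<comment> \<open>The equal probabilities are summed over \<open>B\<close> and written as the
      expectation of a count, which the counting bound controls outcome by outcome.\<close>
    have "real (card B) * prob {\<omega> \<in> space P. c i (D \<omega>) \<le> t \<and> E (D \<omega>)} =
        (\<Sum>j\<in>B. prob {\<omega> \<in> space P. c j (D \<omega>) \<le> t \<and> E (D \<omega>)})"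
      by (simp add: exchangeable)
    also have "\<dots> = (\<integral>\<omega>. (\<Sum>j\<in>B. indicator {\<omega> \<in> space P. c j (D \<omega>) \<le> t \<and> E (D \<omega>)} \<omega>) \<partial>P)"
      by (subst Bochner_Integration.integral_sum) (auto simp: less_top[symmetric])
    also have "\<dots> \<le> (\<integral>\<omega>. t * real (card B) * indicator {\<omega> \<in> space P. E (D \<omega>)} \<omega> \<partial>P)"
    proof (rule integral_mono)
      fix \<omega> assume \<omega>: "\<omega> \<in> space P"
      have "real (card {j\<in>B. c j (D \<omega>) \<le> t}) \<le> t * real (card B)" if "E (D \<omega>)"
        unfolding c_def C_index_def using that t(1)
        by (intro card_calib_index_le) (auto simp: E_def calib_nbrs_def)
      moreover have "(\<Sum>j\<in>B. indicator {\<omega> \<in> space P. c j (D \<omega>) \<le> t \<and> E (D \<omega>)} \<omega>) =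
          real (card {j\<in>B. c j (D \<omega>) \<le> t}) * of_bool (E (D \<omega>))"
        using \<omega> by (simp add: indicator_def Int_def)
      ultimately show "(\<Sum>j\<in>B. indicator {\<omega> \<in> space P. c j (D \<omega>) \<le> t \<and> E (D \<omega>)} \<omega>) \<le>
          t * real (card B) * indicator {\<omega> \<in> space P. E (D \<omega>)} \<omega>"
        using \<omega> by (simp add: indicator_def)
    qed (auto intro!: Bochner_Integration.integrable_sum simp: less_top[symmetric])
    also have "\<dots> = real (card B) * (t * prob {\<omega> \<in> space P. E (D \<omega>)})"
      by simp
    finally have "real (card B) * prob {\<omega> \<in> space P. c i (D \<omega>) \<le> t \<and> E (D \<omega>)} \<le>
        real (card B) * (t * prob {\<omega> \<in> space P. E (D \<omega>)})" .
    moreover have "real (card B) > 0" using i by (auto simp: card_gt_0_iff)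
    ultimately show ?thesis by (simp only: mult_le_cancel_left_pos)
  qed
  moreover have "prob {\<omega> \<in> space P. E (D \<omega>)} \<ge> 0" by simp
  \<comment> \<open>For a null conditioning event the conditional probability is a division by zero,
    hence \<open>0\<close>, and the bound reduces to \<open>0 \<le> t\<close>.\<close>
  ultimately show ?thesis
    using t by (cases "prob {\<omega> \<in> space P. E (D \<omega>)} = 0")
      (auto simp: cond_prob_def E_def c_def divide_le_eq)
qed

end
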